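(* Let $R$ be an integral domain and let $f: R\setminus\{0\}\to\mathbb{Z}_{\ge 0}$ be a function that is uniquely Euclidean on $R$. Then either $R$ is a field, or $R\cong K[x]$ (as rings) for some field $K$.
   Context: An integral domain is a commutative ring with multiplicative identity and no nonzero zero divisors. A function $f: R\setminus\{0\}\to\mathbb{Z}_{\ge 0}$ is uniquely Euclidean on $R$ if for all $a,b\in R$ with $b\neq 0$ there exist unique $q,r\in R$ (i.e. exactly one pair $(q,r)$) such that $a=qb+r$ and ($r=0$ or $f(r)<f(b)$). No other condition is imposed on $f$. $K[x]$ denotes the ring of polynomials in one variable over $K$. *)

theory Defs
  imports "HOL-Algebra.UnivPoly" "HOL-Algebra.QuotRing"
begin

text \<open>
  A map from the nonzero elements of \<open>R\<close> to the natural numbers is represented by a total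
  function \<open>f\<close>. Its values at zero and outside the carrier play no role: \<open>b\<close> is nonzero, and
  \<open>f r\<close> is only relevant when \<open>r\<close> is nonzero. Uniqueness is that of the pair \<open>(q, r)\<close>.
\<close>

definition uniquely_euclidean :: "('a, 'm) ring_scheme \<Rightarrow> ('a \<Rightarrow> nat) \<Rightarrow> bool" where
  "uniquely_euclidean R f \<longleftrightarrow>
     (\<forall>a\<in>carrier R. \<forall>b\<in>carrier R - {\<zero>\<^bsub>R\<^esub>}.
        \<exists>!(q, r)\<in>carrier R \<times> carrier R.
          a = q \<otimes>\<^bsub>R\<^esub> b \<oplus>\<^bsub>R\<^esub> r \<and> (r = \<zero>\<^bsub>R\<^esub> \<or> f r < f b))"

end

theory Submission
  imports Defs "HOL-Algebra.Multiplicative_Group"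
begin

text \<open>
  Uniqueness alone makes \<open>f\<close> behave like a degree. A multiple \<open>a b \<noteq> 0\<close> of \<open>a\<close> with
  \<open>f (a b) < f a\<close> would be a second remainder of \<open>a b\<close> modulo \<open>a\<close>, so \<open>f a \<le> f (a b)\<close>; and
  \<open>a = 0 (a - b) + a = 1 (a - b) + b\<close> forces \<open>f (a - b) \<le> max (f a) (f b)\<close>. Hence the nonzero
  elements of minimal value are exactly the units, and together with zero they form a field \<open>K\<close>.
  If \<open>x\<close> is a nonunit of least value, then the remainders modulo \<open>x\<close> are exactly the elements of
  \<open>K\<close>, and iterated division by \<open>x\<close> expands every element uniquely as a polynomial in \<open>x\<close> over \<open>K\<close>.
\<close>

locale uniquely_euclidean_domain = "domain" R for R (structure) +
  fixes f :: "'a \<Rightarrow> nat"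
  assumes uniquely_euclidean: "uniquely_euclidean R f"
begin

section \<open>Existence and uniqueness of division with remainder\<close>

lemma division:
  assumes "a \<in> carrier R" "b \<in> carrier R" "b \<noteq> \<zero>"
  obtains q r where "q \<in> carrier R" "r \<in> carrier R" "a = q \<otimes> b \<oplus> r" "r = \<zero> \<or> f r < f b"
proof -
  have "\<exists>!(q, r)\<in>carrier R \<times> carrier R. a = q \<otimes> b \<oplus> r \<and> (r = \<zero> \<or> f r < f b)"
    using assms by (intro uniquely_euclidean [unfolded uniquely_euclidean_def, rule_format]) auto
  then obtain p where "(\<lambda>(q, r). (q, r) \<in> carrier R \<times> carrier R \<and>
      a = q \<otimes> b \<oplus> r \<and> (r = \<zero> \<or> f r < f b)) p"
    by (rule ex1E)
  then show thesis using that [of "fst p" "snd p"] by (cases p) simp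
qed

lemma division_unique:
  assumes "b \<in> carrier R" "b \<noteq> \<zero>"
    and "q \<in> carrier R" "r \<in> carrier R" "r = \<zero> \<or> f r < f b"
    and "q' \<in> carrier R" "r' \<in> carrier R" "r' = \<zero> \<or> f r' < f b"
    and eq: "q \<otimes> b \<oplus> r = q' \<otimes> b \<oplus> r'"
  shows "q = q' \<and> r = r'"
proof -
  have "\<exists>!(s, t)\<in>carrier R \<times> carrier R.
      q \<otimes> b \<oplus> r = s \<otimes> b \<oplus> t \<and> (t = \<zero> \<or> f t < f b)"
    using assms by (intro uniquely_euclidean [unfolded uniquely_euclidean_def, rule_format]) auto
  then have "\<exists>\<^sub>\<le>\<^sub>1p. case p of (s, t) \<Rightarrow> (s, t) \<in> carrier R \<times> carrier R \<and>
      q \<otimes> b \<oplus> r = s \<otimes> b \<oplus> t \<and> (t = \<zero> \<or> f t < f b)"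
    unfolding ex1_iff_ex_Uniq by (rule conjunct2)
  then have "(q, r) = (q', r')"
    by (rule Uniq_D) (use assms in simp_all)
  then show ?thesis by simp
qed

section \<open>Degree-like inequalities for \<open>f\<close>\<close>

lemma value_le_mult:
  assumes "a \<in> carrier R" "b \<in> carrier R" "a \<noteq> \<zero>" "b \<noteq> \<zero>"
  shows "f a \<le> f (a \<otimes> b)"
proof (rule ccontr)
  assume "\<not> ?thesis"
  \<comment> \<open>Two divisions of \<open>a \<otimes> b\<close> by \<open>a\<close> are compared:
    quotient \<open>\<zero>\<close> with remainder \<open>a \<otimes> b\<close>, and quotient
    \<open>b\<close> with remainder \<open>\<zero>\<close>.\<close>
  then have "\<zero> = b \<and> a \<otimes> b = \<zero>"
    using assms by (intro division_unique [of a]) (auto simp: m_comm)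
  then show False using assms by simp
qed

lemma value_minus_le:
  assumes "a \<in> carrier R" "b \<in> carrier R" "a \<noteq> \<zero>" "b \<noteq> \<zero>" "a \<noteq> b"
  shows "f (a \<ominus> b) \<le> max (f a) (f b)"
proof (rule ccontr)
  assume *: "\<not> ?thesis"
  have nz: "a \<ominus> b \<noteq> \<zero>" using assms by simp
  have "\<zero> \<otimes> (a \<ominus> b) \<oplus> a = \<one> \<otimes> (a \<ominus> b) \<oplus> b"
    using assms by (simp add: minus_eq a_assoc l_neg)
  then have "\<zero> = \<one> \<and> a = b"
    using assms nz * by (intro division_unique [of "a \<ominus> b"]) auto
  then show False by simp
qed

text \<open>Negation is multiplication by \<open>\<ominus> \<one>\<close>, which cannot lower the
  value; applying it twice returns to \<open>a\<close>, so it cannot raise the value either.\<close>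

lemma value_a_inv:
  assumes "a \<in> carrier R" "a \<noteq> \<zero>"
  shows "f (\<ominus> a) = f a"
proof (rule antisym)
  have "f b \<le> f (\<ominus> b)" if "b \<in> carrier R" "b \<noteq> \<zero>" for b
    using value_le_mult [of b "\<ominus> \<one>"] that by (simp add: r_minus)
  from this [of a] this [of "\<ominus> a"] assms
  show "f a \<le> f (\<ominus> a)" "f (\<ominus> a) \<le> f a" by auto
qed

lemma value_add_le:
  assumes "a \<in> carrier R" "b \<in> carrier R" "a \<noteq> \<zero>" "b \<noteq> \<zero>" "a \<oplus> b \<noteq> \<zero>"
  shows "f (a \<oplus> b) \<le> max (f a) (f b)"
proof -
  have "a \<noteq> \<ominus> b" using assms l_neg by auto
  then have "f (a \<ominus> (\<ominus> b)) \<le> max (f a) (f (\<ominus> b))"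
    using assms by (intro value_minus_le) auto
  then show ?thesis using assms by (simp add: minus_eq value_a_inv)
qed

lemma value_one_le: "a \<in> carrier R \<Longrightarrow> a \<noteq> \<zero> \<Longrightarrow> f \<one> \<le> f a"
  using value_le_mult [of \<one> a] by simp

section \<open>The units and the field that they form with zero\<close>

lemma Units_iff_value:
  assumes u: "u \<in> carrier R" "u \<noteq> \<zero>"
  shows "u \<in> Units R \<longleftrightarrow> f u \<le> f \<one>"
proof
  assume unit: "u \<in> Units R"
  have "inv u \<noteq> \<zero>"
  proof
    assume inv: "inv u = \<zero>"
    have "u \<otimes> \<zero> = \<one>" using Units_r_inv [OF unit] unfolding inv .
    then show False using u by simp
  qed
  then show "f u \<le> f \<one>"
    using value_le_mult [of u "inv u"] Units_r_inv [OF unit] Units_inv_closed [OF unit] u by simp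
next
  assume le: "f u \<le> f \<one>"
  obtain q r where qr: "q \<in> carrier R" "r \<in> carrier R" "\<one> = q \<otimes> u \<oplus> r" "r = \<zero> \<or> f r < f u"
    using division [OF one_closed u] .
  \<comment> \<open>No nonzero element has a value below \<open>f \<one>\<close>, so a nonzero
    remainder modulo \<open>u\<close> is impossible.\<close>
  then have "r = \<zero>" using le value_one_le [of r] by (meson leD order_trans)
  then have qu: "q \<otimes> u = \<one>" using qr(3) [symmetric] qr(1) u by simp
  moreover have "u \<otimes> q = \<one>" using m_comm [OF u(1) qr(1)] qu by (rule trans)
  ultimately show "u \<in> Units R" using qr(1) u(1) unfolding Units_def by blast
qed

text \<open>Turns membership in the future field into a bound on \<open>f\<close>, so that closure
  under addition and negation can be read off from the inequalities for \<open>f\<close>.\<close>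

lemma mem_insert_Units_iff:
  "a \<in> insert \<zero> (Units R) \<longleftrightarrow> a \<in> carrier R \<and> (a = \<zero> \<or> f a \<le> f \<one>)"
proof (cases "a = \<zero>")
  case False
  then show ?thesis using Units_iff_value [of a] Units_closed [of a] by blast
qed simp

lemma add_mem_insert_Units:
  assumes "a \<in> insert \<zero> (Units R)" "b \<in> insert \<zero> (Units R)"
  shows "a \<oplus> b \<in> insert \<zero> (Units R)"
proof (cases "a = \<zero> \<or> b = \<zero> \<or> a \<oplus> b = \<zero>")
  case True
  then show ?thesis using assms unfolding mem_insert_Units_iff by auto
next
  case False
  then show ?thesis
    using assms value_add_le [of a b] unfolding mem_insert_Units_iff by auto
qed

lemma a_inv_mem_insert_Units:
  assumes a: "a \<in> insert \<zero> (Units R)"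
  shows "\<ominus> a \<in> insert \<zero> (Units R)"
proof (cases "a = \<zero>")
  case False
  then show ?thesis using a unfolding mem_insert_Units_iff by (simp add: value_a_inv)
qed simp

end

text \<open>The record is built afresh instead of updating \<open>R\<close>, which drops any
  extension fields and gives the type \<open>'a ring\<close> required of \<open>K\<close>. For
  arbitrary \<open>R\<close> it need not be a ring: closure under addition will come from
  \<open>f\<close>.\<close>

definition unit_ring :: "('a, 'm) ring_scheme \<Rightarrow> 'a ring" where
  "unit_ring R = \<lparr>carrier = insert \<zero>\<^bsub>R\<^esub> (Units R), monoid.mult = monoid.mult R, one = \<one>\<^bsub>R\<^esub>,
     zero = \<zero>\<^bsub>R\<^esub>, add = add R\<rparr>"

lemma unit_ring_simps [simp]:
  "carrier (unit_ring R) = insert \<zero>\<^bsub>R\<^esub> (Units R)"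
  "monoid.mult (unit_ring R) = monoid.mult R" "one (unit_ring R) = \<one>\<^bsub>R\<^esub>"
  "zero (unit_ring R) = \<zero>\<^bsub>R\<^esub>" "add (unit_ring R) = add R"
  by (simp_all add: unit_ring_def)

context uniquely_euclidean_domain
begin

lemma unit_ring_field: "field (unit_ring R)"
proof -
  have sub: "a \<in> carrier R" if "a \<in> insert \<zero> (Units R)" for a using that by auto
  have mult: "a \<otimes> b \<in> insert \<zero> (Units R)"
    if "a \<in> insert \<zero> (Units R)" "b \<in> insert \<zero> (Units R)" for a b
    using that by auto
  have "cring (unit_ring R)"
  proof (rule cringI)
    show "abelian_group (unit_ring R)"
    proof (rule abelian_groupI; unfold unit_ring_simps)
      show "\<exists>b\<in>insert \<zero> (Units R). b \<oplus> a = \<zero>" if "a \<in> insert \<zero> (Units R)" for a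
        using that a_inv_mem_insert_Units sub l_neg by blast
    qed (use add_mem_insert_Units sub in \<open>simp_all add: a_ac del: insert_iff\<close>, simp)
    show "comm_monoid (unit_ring R)"
      by (rule comm_monoidI; unfold unit_ring_simps)
        (use mult sub in \<open>simp_all add: m_ac del: insert_iff\<close>, simp)
  qed (use sub in \<open>simp add: l_distr del: insert_iff\<close>)
  then show ?thesis
  proof (rule cring.cring_fieldI2; unfold unit_ring_simps)
    show "\<zero> \<noteq> \<one>" by simp
    show "\<exists>b\<in>insert \<zero> (Units R). a \<otimes> b = \<one>" if "a \<in> insert \<zero> (Units R)" "a \<noteq> \<zero>" for a
      using that Units_inv_Units Units_r_inv by blast
  qed
qed

section \<open>Multiplication by a nonunit and independence of its powers\<close>

lemma value_less_mult_nonunit: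
  assumes q: "q \<in> carrier R" "q \<noteq> \<zero>" and x: "x \<in> carrier R" "x \<noteq> \<zero>" "x \<notin> Units R"
  shows "f q < f (q \<otimes> x)"
proof (rule ccontr)
  assume "\<not> ?thesis"
  then have ge: "f (q \<otimes> x) \<le> f q" by simp
  have "q \<otimes> x \<in> carrier R" "q \<otimes> x \<noteq> \<zero>" using q x by (simp_all add: integral_iff)
  \<comment> \<open>Dividing \<open>q\<close> by \<open>q \<otimes> x\<close> leaves a remainder
    \<open>t = q \<otimes> (\<one> \<ominus> s \<otimes> x)\<close>. It is nonzero because
    \<open>x\<close> is not a unit, and as a multiple of \<open>q\<close> it has value at least
    \<open>f q\<close>, too large for a remainder.\<close>
  then obtain s t where st: "s \<in> carrier R" "t \<in> carrier R" "q = s \<otimes> (q \<otimes> x) \<oplus> t"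
    "t = \<zero> \<or> f t < f (q \<otimes> x)"
    using division [OF q(1)] by blast
  have "q \<ominus> s \<otimes> (q \<otimes> x) = (s \<otimes> (q \<otimes> x) \<oplus> t) \<ominus> s \<otimes> (q \<otimes> x)"
    using st(3) by (rule arg_cong)
  also have "\<dots> = t"
    using st(1,2) q(1) x(1) by (simp add: minus_eq a_ac r_neg1 r_neg)
  finally have t: "q \<otimes> (\<one> \<ominus> s \<otimes> x) = t"
    using st(1) q(1) x(1) by (simp add: minus_eq r_distr r_minus m_lcomm)
  have nz: "\<one> \<ominus> s \<otimes> x \<noteq> \<zero>"
  proof
    assume "\<one> \<ominus> s \<otimes> x = \<zero>"
    then have "s \<otimes> x = \<one>" using st(1) x(1) by simp
    moreover from this have "x \<otimes> s = \<one>" using m_comm [OF x(1) st(1)] by simp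
    ultimately show False using x(1,3) st(1) unfolding Units_def by blast
  qed
  have cl: "\<one> \<ominus> s \<otimes> x \<in> carrier R" using st(1) x(1) by simp
  have "t \<noteq> \<zero>" using nz cl q t integral by blast
  moreover have "f q \<le> f t" using value_le_mult [OF q(1) cl q(2) nz] unfolding t .
  ultimately show False using st(4) ge by simp
qed

text \<open>The constant coefficient is an admissible remainder modulo \<open>x\<close>, since
  \<open>f \<one> < f x\<close>. Comparing the sum, written as
  \<open>?q \<otimes> x \<oplus> c 0\<close>, with
  \<open>\<zero> \<otimes> x \<oplus> \<zero>\<close> kills both \<open>c 0\<close> and
  \<open>?q\<close>; the induction continues with the shifted coefficients of
  \<open>?q\<close>.\<close>

lemma finsum_power_eq_zero_imp:
  fixes n :: nat
  assumes x: "x \<in> carrier R" "x \<noteq> \<zero>" "x \<notin> Units R"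
    and "\<And>i. c i \<in> insert \<zero> (Units R)" "(\<Oplus>i\<in>{..n}. c i \<otimes> x [^] i) = \<zero>"
  shows "\<forall>i\<le>n. c i = \<zero>"
  using assms(4,5)
proof (induction n arbitrary: c)
  case 0
  then have "c 0 \<in> carrier R" unfolding mem_insert_Units_iff by blast
  then show ?case using 0(2) by simp
next
  case (Suc n)
  have c: "c i \<in> carrier R" for i using Suc.prems(1) [of i] unfolding mem_insert_Units_iff by blast
  have "f \<one> < f x" using Units_iff_value [of x] x by simp
  then have small: "c 0 = \<zero> \<or> f (c 0) < f x"
    using Suc.prems(1) [of 0] unfolding mem_insert_Units_iff by auto
  let ?q = "\<Oplus>i\<in>{..n}. c (Suc i) \<otimes> x [^] i"
  have q: "?q \<in> carrier R" using c x by (intro finsum_closed) auto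
  have "(\<Oplus>i\<in>{..Suc n}. c i \<otimes> x [^] i) = (\<Oplus>i\<in>{..n}. c (Suc i) \<otimes> x [^] Suc i) \<oplus> c 0 \<otimes> x [^] (0::nat)"
    using c x(1) by (intro finsum_Suc2) auto
  also have "\<dots> = ?q \<otimes> x \<oplus> c 0"
    using c x(1) by (simp add: finsum_ldistr m_assoc Pi_def)
  finally have "?q \<otimes> x \<oplus> c 0 = \<zero>" using Suc.prems(2) by (rule trans [OF sym])
  then have "?q \<otimes> x \<oplus> c 0 = \<zero> \<otimes> x \<oplus> \<zero>" using x(1) by simp
  then have *: "?q = \<zero> \<and> c 0 = \<zero>"
    using small by (intro division_unique [OF x(1,2) q c]) auto
  have IH: "\<forall>i\<le>n. c (Suc i) = \<zero>"
    by (rule Suc.IH [OF Suc.prems(1)]) (rule conjunct1 [OF *])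
  show ?case
  proof (intro allI impI)
    fix i assume "i \<le> Suc n"
    then show "c i = \<zero>" using IH conjunct2 [OF *] by (cases i) simp_all
  qed
qed

section \<open>Evaluation at a least nonunit as an isomorphism\<close>

lemma iso_UP_unit_ring:
  assumes x: "x \<in> carrier R" "x \<noteq> \<zero>" "x \<notin> Units R"
    and least: "\<And>y. y \<in> carrier R \<Longrightarrow> y \<noteq> \<zero> \<Longrightarrow> y \<notin> Units R \<Longrightarrow> f x \<le> f y"
  shows "R \<simeq> UP (unit_ring R)"
proof -
  let ?K = "unit_ring R" and ?P = "UP (unit_ring R)"
  interpret K: field ?K by (rule unit_ring_field)
  have K_carrier: "k \<in> carrier R" if "k \<in> carrier ?K" for k using that by auto
  have id_hom: "id \<in> ring_hom ?K R"
    by (rule ring_hom_memI) (use K_carrier in \<open>simp_all del: unit_ring_simps(1)\<close>)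
  have "UP_pre_univ_prop ?K R id"
    by (rule UP_pre_univ_propI [OF K.is_cring is_cring id_hom])
  then interpret UPK: UP_pre_univ_prop ?K R id ?P by simp_all
  \<comment> \<open>\<open>id\<close> is the inclusion of the coefficient field in \<open>R\<close>,
    so this map substitutes \<open>x\<close> for the variable.\<close>
  let ?ev = "eval ?K R id x"
  have hom: "?ev \<in> ring_hom ?P R" using x(1) by (rule UPK.eval_ring_hom)
  interpret ev: ring_hom_ring ?P R ?ev
    by (rule ring_hom_ringI2 [OF UPK.UP_ring ring_axioms hom])

  \<comment> \<open>Induction on the value: division by \<open>x\<close> leaves a constant remainder
    and a quotient of smaller value, whose preimage is multiplied by the variable and corrected by
    that constant.\<close>
  have surj: "a \<in> ?ev ` carrier ?P" if "a \<in> carrier R" for a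
    using that
  proof (induction "f a" arbitrary: a rule: less_induct)
    case less
    have const: "monom ?P k 0 \<in> carrier ?P \<and> ?ev (monom ?P k 0) = k" if "k \<in> carrier ?K" for k
      using UPK.eval_const [OF x(1) that] UPK.monom_closed [OF that] by simp
    show ?case
    proof (cases "a \<in> carrier ?K")
      case True
      then show ?thesis using const [OF True] by (metis image_eqI)
    next
      case False
      then have a: "a \<in> carrier R" "a \<noteq> \<zero>" "a \<notin> Units R" using less.prems by auto
      obtain q k where qk: "q \<in> carrier R" "k \<in> carrier R" "a = q \<otimes> x \<oplus> k" "k = \<zero> \<or> f k < f x"
        using division [OF a(1) x(1,2)] .
      \<comment> \<open>A nonzero nonunit would have value at least \<open>f x\<close>, by the
        choice of \<open>x\<close>.\<close>
      have k: "k \<in> carrier ?K" using qk(2,4) least [of k] by fastforce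
      have "q \<noteq> \<zero>" using qk(2,3) False k x(1) by auto
      then have "f q < f (q \<otimes> x)" using qk(1) x by (intro value_less_mult_nonunit)
      \<comment> \<open>Removing a nonzero constant \<open>k\<close> from \<open>a\<close> does not
        raise the value, because \<open>f k \<le> f \<one> \<le> f a\<close>.\<close>
      also have "f (q \<otimes> x) \<le> f a"
      proof (cases "k = \<zero>")
        case True
        then show ?thesis using qk(1,3) x(1) by simp
      next
        case k0: False
        have "q \<otimes> x = a \<ominus> k" using qk(1-3) x(1) by (simp add: minus_eq a_assoc r_neg)
        moreover have "f k \<le> f a"
        proof -
          have "f k \<le> f \<one>" using k k0 mem_insert_Units_iff [of k] by simp
          then show ?thesis using value_one_le [OF a(1,2)] by simp
        qed
        moreover have "a \<noteq> k" using False k by blast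
        ultimately show ?thesis using value_minus_le [OF a(1) qk(2) a(2) k0] by simp
      qed
      finally have "q \<in> ?ev ` carrier ?P" using less.hyps qk(1) by blast
      then obtain p where p: "p \<in> carrier ?P" "?ev p = q" by blast
      let ?X = "monom ?P \<one> 1"
      have X: "?X \<in> carrier ?P" "?ev ?X = x"
        using UPK.monom_closed [of \<one> 1] UPK.eval_monom1 [OF x(1)] by simp_all
      have "?ev (p \<otimes>\<^bsub>?P\<^esub> ?X \<oplus>\<^bsub>?P\<^esub> monom ?P k 0) = a"
        using p X const [OF k] qk(3) by simp
      moreover have "p \<otimes>\<^bsub>?P\<^esub> ?X \<oplus>\<^bsub>?P\<^esub> monom ?P k 0 \<in> carrier ?P"
        using p X const [OF k] by simp
      ultimately show ?thesis by (metis image_eqI)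
    qed
  qed

  \<comment> \<open>Injectivity: independence of the powers of \<open>x\<close> kills the
    coefficients up to the degree, and those above it vanish anyway.\<close>
  have "p = \<zero>\<^bsub>?P\<^esub>" if p: "p \<in> carrier ?P" "?ev p = \<zero>" for p
  proof -
    have coeff: "coeff ?P p i \<in> insert \<zero> (Units R)" for i
      using UPK.coeff_closed [OF p(1), of i] by simp
    have "(\<Oplus>i\<in>{..deg ?K p}. coeff ?P p i \<otimes> x [^] i) = \<zero>"
      using p(2) UPK.eval_on_carrier [OF p(1), of R id x] by simp
    then have "\<forall>i\<le>deg ?K p. coeff ?P p i = \<zero>"
      using coeff by (intro finsum_power_eq_zero_imp [OF x])
    then have "coeff ?P p i = \<zero>" for i
      using UPK.deg_aboveD [OF _ p(1), of i] by (cases "i \<le> deg ?K p") auto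
    then show ?thesis using p by (intro UPK.up_eqI) auto
  qed
  then have "a_kernel ?P R ?ev = {\<zero>\<^bsub>?P\<^esub>}" unfolding a_kernel_def' by auto
  then have "inj_on ?ev (carrier ?P)" by (rule ev.trivial_ker_imp_inj)
  moreover have "?ev ` carrier ?P = carrier R" using surj by auto
  ultimately have "?ev \<in> ring_iso ?P R"
    using hom by (simp add: ring_iso_def bij_betw_def)
  then have "?P \<simeq> R" unfolding is_ring_iso_def by (metis empty_iff)
  then show ?thesis by (rule ring_iso_sym [OF UPK.UP_ring])
qed

end

theorem theorem4p4:
  fixes R :: "('a, 'm) ring_scheme" and f :: "'a \<Rightarrow> nat"
  assumes "domain R" and "uniquely_euclidean R f"
  shows "field R \<or> (\<exists>K :: 'a ring. field K \<and> R \<simeq> UP K)"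
proof -
  interpret uniquely_euclidean_domain R f
    using assms by (simp add: uniquely_euclidean_domain_def uniquely_euclidean_domain_axioms_def)
  \<comment> \<open>\<open>?N\<close> describes the nonzero nonunits. If there are any, the
    well-ordering of the naturals yields one of least value; if there are none, \<open>R\<close> is
    a field.\<close>
  let ?N = "\<lambda>y. y \<in> carrier R \<and> y \<noteq> \<zero>\<^bsub>R\<^esub> \<and> y \<notin> Units R"
  show ?thesis
  proof (cases "\<exists>y. ?N y")
    case True
    then obtain x where "?N x" "\<And>y. ?N y \<Longrightarrow> f x \<le> f y"
      using exists_least_iff [of "\<lambda>n. \<exists>y. ?N y \<and> f y = n"] by (metis not_le_imp_less)
    then have "R \<simeq> UP (unit_ring R)" by (intro iso_UP_unit_ring) auto
    then show ?thesis using unit_ring_field by blast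
  next
    case False
    then have "\<exists>b\<in>carrier R. a \<otimes>\<^bsub>R\<^esub> b = \<one>\<^bsub>R\<^esub>" if "a \<in> carrier R" "a \<noteq> \<zero>\<^bsub>R\<^esub>" for a
      using that Units_inv_closed [of a] Units_r_inv [of a] by blast
    then have "field R" by (intro cring_fieldI2) auto
    then show ?thesis ..
  qed
qed

end
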